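(* Let $n\ge 1$, let $X_1,\dots,X_n$ be (nonempty) compact Hausdorff spaces, let $X=X_1\times\cdots\times X_n$, and let $M=\left\{\sum_{i=1}^n g_i(x_i) : g_i\in C(X_i),\ i=1,\dots,n\right\}\subset C(X)$. For every $f\in C(X)$, the error of approximation $E(f)=\inf_{g\in M}\|f-g\|_{C(X)}$ satisfies $$E(f)=\sup_{l\subset X}\left|\int_X f\,d\mu_l\right|,$$ where the supremum is taken over all minimal projection cycles $l$ of $X$, and $\mu_l$ is the normalized measure associated with $l$ (the supremum over the empty set being understood as $0$).
   Context: $C(X)$ and $C(X_i)$ denote the spaces of continuous real-valued functions with the uniform (sup) norm. Let $\pi_i:X\to X_i$ be the coordinate projections. For a point $a\in X_i$, $\chi_a$ denotes the characteristic function of the single-point set $\{a\}$. A projection cycle in $X$ is a nonempty finite set $p=\{x_1,\dots,x_m\}\subset X$ (with $x_1,\dots,x_m$ pairwise distinct) for which there exists a vector $\lambda=(\lambda_1,\dots,\lambda_m)$ with all coordinates nonzero real numbers such that $$\sum_{j=1}^m \lambda_j\chi_{\pi_i(x_j)}=0,\qquad i=1,\dots,n.$$ Such a $\lambda$ is called a vector associated with $p$. A projection cycle is minimal if it contains no projection cycle as a proper subset. For a minimal projection cycle $l=\{x_1,\dots,x_m\}$ the associated vector $\lambda$ is unique up to multiplication by a nonzero constant; normalizing it by $\sum_{j=1}^m|\lambda_j|=1$ determines, uniquely up to sign, the measure $$\mu_l=\sum_{j=1}^m\lambda_j\delta_{x_j},$$ where $\delta_x$ is the unit point mass at $x$. The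 quantity $\left|\int_X f\,d\mu_l\right|$ does not depend on the choice of sign. *)

theory Defs
  imports "HOL-Analysis.Analysis" "HOL-Probability.Probability"
begin

text \<open>
  The spaces \<open>X\<^sub>1, \<dots>, X\<^sub>n\<close> are topologies \<open>X 1, \<dots>, X n\<close> on subsets of one type \<open>'a\<close>.  This is no
  restriction on the family: finitely many spaces of different types embed into their disjoint sum.
  A point of \<open>X\<^sub>1 \<times> \<dots> \<times> X\<^sub>n\<close> is an extensional function on \<open>{1..n}\<close>, and the projection \<open>\<pi>\<^sub>i\<close> is
  \<open>\<lambda>x. x i\<close>.
\<close>

abbreviation prod_space :: "nat \<Rightarrow> (nat \<Rightarrow> 'a topology) \<Rightarrow> (nat \<Rightarrow> 'a) topology" where
  "prod_space n X \<equiv> product_topology X {1..n}"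

text \<open>
  The library's space of (bounded, extensional) continuous functions, with the uniform metric.
  Boundedness is automatic for compact \<open>T\<close>.
\<close>

abbreviation C_space :: "'b topology \<Rightarrow> ('b \<Rightarrow> real) metric" where
  "C_space T \<equiv> cfunspace T euclidean_metric"

definition sum_functions :: "nat \<Rightarrow> (nat \<Rightarrow> 'a topology) \<Rightarrow> ((nat \<Rightarrow> 'a) \<Rightarrow> real) set" where
  "sum_functions n X =
     {restrict (\<lambda>x. \<Sum>i=1..n. g i (x i)) (topspace (prod_space n X)) | g.
        \<forall>i\<in>{1..n}. g i \<in> mspace (C_space (X i))}"

definition approx_error :: "nat \<Rightarrow> (nat \<Rightarrow> 'a topology) \<Rightarrow> ((nat \<Rightarrow> 'a) \<Rightarrow> real) \<Rightarrow> real" where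
  "approx_error n X f = (INF g\<in>sum_functions n X. mdist (C_space (prod_space n X)) f g)"

text \<open>
  A vector associated with \<open>p\<close> is indexed by the points of \<open>p\<close> themselves; its values outside \<open>p\<close>
  are irrelevant.
\<close>

definition associated_vector ::
    "nat \<Rightarrow> (nat \<Rightarrow> 'a topology) \<Rightarrow> (nat \<Rightarrow> 'a) set \<Rightarrow> ((nat \<Rightarrow> 'a) \<Rightarrow> real) \<Rightarrow> bool" where
  "associated_vector n X p c \<longleftrightarrow>
     (\<forall>x\<in>p. c x \<noteq> 0) \<and>
     (\<forall>i\<in>{1..n}. \<forall>a\<in>topspace (X i). (\<Sum>x\<in>p. c x * indicator {x i} a) = 0)"

definition projection_cycle :: "nat \<Rightarrow> (nat \<Rightarrow> 'a topology) \<Rightarrow> (nat \<Rightarrow> 'a) set \<Rightarrow> bool" where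
  "projection_cycle n X p \<longleftrightarrow>
     finite p \<and> p \<noteq> {} \<and> p \<subseteq> topspace (prod_space n X) \<and> (\<exists>c. associated_vector n X p c)"

definition minimal_projection_cycle :: "nat \<Rightarrow> (nat \<Rightarrow> 'a topology) \<Rightarrow> (nat \<Rightarrow> 'a) set \<Rightarrow> bool" where
  "minimal_projection_cycle n X l \<longleftrightarrow>
     projection_cycle n X l \<and> (\<forall>p. p \<subset> l \<longrightarrow> \<not> projection_cycle n X p)"

definition normalized_vector ::
    "nat \<Rightarrow> (nat \<Rightarrow> 'a topology) \<Rightarrow> (nat \<Rightarrow> 'a) set \<Rightarrow> ((nat \<Rightarrow> 'a) \<Rightarrow> real) \<Rightarrow> bool" where
  "normalized_vector n X l c \<longleftrightarrow> associated_vector n X l c \<and> (\<Sum>x\<in>l. \<bar>c x\<bar>) = 1"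

definition borel_of_top :: "'b topology \<Rightarrow> 'b measure" where
  "borel_of_top T = sigma (topspace T) {U. openin T U}"

text \<open>
  The integral of \<open>f\<close> with respect to the signed measure \<open>\<Sum>x\<in>l. c x * \<delta>\<^sub>x\<close> on the Borel sets of \<open>T\<close>,
  where \<open>\<delta>\<^sub>x\<close> is the unit point mass \<^const>\<open>return\<close>.
\<close>

definition point_mass_integral ::
    "'b topology \<Rightarrow> 'b set \<Rightarrow> ('b \<Rightarrow> real) \<Rightarrow> ('b \<Rightarrow> real) \<Rightarrow> real" where
  "point_mass_integral T l c f = (\<Sum>x\<in>l. c x * (\<integral>y. f y \<partial>return (borel_of_top T) x))"

text \<open>
  The integral with respect to \<open>\<mu>\<^sub>l\<close>.  The measure is only determined up to sign; \<open>SOME\<close> fixes a sign.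
  For a minimal cycle a normalized vector exists, and the absolute value of the integral does not
  depend on the choice: see \<open>normalized_vector_exists\<close>, \<open>normalized_vector_unique\<close> and
  \<open>abs_cycle_integral_eq\<close> below.
\<close>

definition cycle_integral ::
    "nat \<Rightarrow> (nat \<Rightarrow> 'a topology) \<Rightarrow> (nat \<Rightarrow> 'a) set \<Rightarrow> ((nat \<Rightarrow> 'a) \<Rightarrow> real) \<Rightarrow> real" where
  "cycle_integral n X l f =
     point_mass_integral (prod_space n X) l (SOME c. normalized_vector n X l c) f"

lemma associated_vector_scale:
  assumes "associated_vector n X p v" "c \<noteq> 0"
  shows "associated_vector n X p (\<lambda>x. c * v x)"
  using assms by (auto simp: associated_vector_def mult.assoc simp flip: sum_distrib_left)

lemma normalized_vector_exists:
  assumes "projection_cycle n X l"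
  shows "\<exists>v. normalized_vector n X l v"
proof -
  obtain v where v: "associated_vector n X l v" and l: "finite l" "l \<noteq> {}"
    using assms by (auto simp: projection_cycle_def)
  define s where "s = (\<Sum>x\<in>l. \<bar>v x\<bar>)"
  have s: "s > 0"
    unfolding s_def using v l by (intro sum_pos) (auto simp: associated_vector_def)
  have "(\<Sum>x\<in>l. \<bar>1 / s * v x\<bar>) = 1 / s * (\<Sum>x\<in>l. \<bar>v x\<bar>)"
    unfolding sum_distrib_left using s by (intro sum.cong) (auto simp: abs_mult)
  also have "\<dots> = 1" using s by (simp flip: s_def)
  finally have "normalized_vector n X l (\<lambda>x. 1 / s * v x)"
    unfolding normalized_vector_def using associated_vector_scale[OF v, of "1 / s"] s by simp
  then show ?thesis by blast
qed

lemma associated_vector_unique: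
  assumes l: "minimal_projection_cycle n X l"
    and v: "associated_vector n X l v" and w: "associated_vector n X l w"
  shows "\<exists>c. c \<noteq> 0 \<and> (\<forall>x\<in>l. w x = c * v x)"
proof -
  have fin: "finite l" and ne: "l \<noteq> {}" and sub: "l \<subseteq> topspace (prod_space n X)"
    and min: "\<And>p. p \<subset> l \<Longrightarrow> \<not> projection_cycle n X p"
    using l by (auto simp: minimal_projection_cycle_def projection_cycle_def)
  obtain x0 where x0: "x0 \<in> l" using ne by blast
  have v0: "v x0 \<noteq> 0" and w0: "w x0 \<noteq> 0"
    using v w x0 by (auto simp: associated_vector_def)
  define c where "c = w x0 / v x0"
  define u where "u = (\<lambda>x. w x - c * v x)"
  define p where "p = {x \<in> l. u x \<noteq> 0}"
  have "x0 \<notin> p" using v0 by (simp add: p_def u_def c_def)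
  then have pl: "p \<subset> l" using x0 by (auto simp: p_def)
  have "associated_vector n X p u"
    unfolding associated_vector_def
  proof (intro conjI ballI)
    fix i a assume ia: "i \<in> {1..n}" "a \<in> topspace (X i)"
    have "(\<Sum>x\<in>p. u x * indicator {x i} a) = (\<Sum>x\<in>l. u x * indicator {x i} a)"
      using fin by (intro sum.mono_neutral_left) (auto simp: p_def)
    also have "\<dots> = (\<Sum>x\<in>l. w x * indicator {x i} a) - c * (\<Sum>x\<in>l. v x * indicator {x i} a)"
      by (simp add: u_def algebra_simps sum_subtractf sum_distrib_left)
    also have "\<dots> = 0" using v w ia by (simp add: associated_vector_def)
    finally show "(\<Sum>x\<in>p. u x * indicator {x i} a) = 0" .
  qed (auto simp: p_def)
  then have "p = {}"
    using min[OF pl] fin sub pl by (auto simp: projection_cycle_def intro: finite_subset)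
  then have "\<forall>x\<in>l. w x = c * v x" by (auto simp: p_def u_def)
  moreover have "c \<noteq> 0" using v0 w0 by (simp add: c_def)
  ultimately show ?thesis by blast
qed

lemma normalized_vector_unique:
  assumes l: "minimal_projection_cycle n X l"
    and v: "normalized_vector n X l v" and w: "normalized_vector n X l w"
  shows "(\<forall>x\<in>l. w x = v x) \<or> (\<forall>x\<in>l. w x = - v x)"
proof -
  obtain c where c: "\<forall>x\<in>l. w x = c * v x"
    using associated_vector_unique[OF l, of v w] v w by (auto simp: normalized_vector_def)
  have "1 = (\<Sum>x\<in>l. \<bar>w x\<bar>)" using w by (simp add: normalized_vector_def)
  also have "\<dots> = \<bar>c\<bar> * (\<Sum>x\<in>l. \<bar>v x\<bar>)"
    unfolding sum_distrib_left using c by (intro sum.cong) (auto simp: abs_mult)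
  also have "\<dots> = \<bar>c\<bar>" using v by (simp add: normalized_vector_def)
  finally have "c = 1 \<or> c = -1" by linarith
  then show ?thesis using c by auto
qed

lemma abs_cycle_integral_eq:
  assumes l: "minimal_projection_cycle n X l" and v: "normalized_vector n X l v"
  shows "\<bar>cycle_integral n X l f\<bar> = \<bar>point_mass_integral (prod_space n X) l v f\<bar>"
proof -
  define w where "w = (SOME v. normalized_vector n X l v)"
  have "normalized_vector n X l w" unfolding w_def by (rule someI[of "normalized_vector n X l", OF v])
  from normalized_vector_unique[OF l v this]
  have "point_mass_integral (prod_space n X) l w f = point_mass_integral (prod_space n X) l v f \<or>
        point_mass_integral (prod_space n X) l w f = - point_mass_integral (prod_space n X) l v f"
  proof
    assume "\<forall>x\<in>l. w x = v x"
    then show ?thesis by (simp add: point_mass_integral_def)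
  next
    assume "\<forall>x\<in>l. w x = - v x"
    then show ?thesis by (simp add: point_mass_integral_def sum_negf)
  qed
  then show ?thesis by (auto simp: cycle_integral_def w_def)
qed

lemma point_mass_integral_eq:
  assumes l: "l \<subseteq> topspace T" and f: "continuous_map T euclideanreal f"
  shows "point_mass_integral T l v f = (\<Sum>x\<in>l. v x * f x)"
proof -
  have sp: "space (borel_of_top T) = topspace T"
    by (simp add: borel_of_top_def space_measure_of_conv)
  have sets: "sets (borel_of_top T) = sigma_sets (topspace T) {U. openin T U}"
    unfolding borel_of_top_def by (rule sets_measure_of) (auto dest: openin_subset)
  have meas: "f \<in> borel_measurable (borel_of_top T)"
  proof (rule borel_measurableI)
    fix S :: "real set" assume "open S"
    then have "openin T {x \<in> topspace T. f x \<in> S}"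
      using openin_continuous_map_preimage[OF f, of S] by (metis open_openin)
    moreover have "f -` S \<inter> topspace T = {x \<in> topspace T. f x \<in> S}" by auto
    ultimately show "f -` S \<inter> space (borel_of_top T) \<in> sets (borel_of_top T)"
      unfolding sp sets by (simp add: sigma_sets.Basic)
  qed
  have "(\<integral>y. f y \<partial>return (borel_of_top T) x) = f x" if "x \<in> l" for x
    using that l by (intro integral_return meas) (auto simp: sp)
  then show ?thesis
    by (simp add: point_mass_integral_def)
qed

lemma sum_functions_subset:
  assumes comp: "\<And>i. i \<in> {1..n} \<Longrightarrow> compact_space (X i)"
  shows "sum_functions n X \<subseteq> mspace (C_space (prod_space n X))"
proof
  fix h assume "h \<in> sum_functions n X"
  then obtain g where h: "h = restrict (\<lambda>x. \<Sum>i=1..n. g i (x i)) (topspace (prod_space n X))"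
    and g: "\<And>i. i \<in> {1..n} \<Longrightarrow> continuous_map (X i) euclideanreal (g i)"
    by (auto simp: sum_functions_def)
  have cont: "continuous_map (prod_space n X) euclideanreal h"
  proof (rule continuous_map_eq)
    show "continuous_map (prod_space n X) euclideanreal (\<lambda>x. \<Sum>i=1..n. g i (x i))"
    proof (rule continuous_map_sum)
      fix i assume i: "i \<in> {1..n}"
      show "continuous_map (prod_space n X) euclideanreal (\<lambda>x. g i (x i))"
        using continuous_map_compose[OF continuous_map_product_projection[OF i, of X] g[OF i]]
        by (simp add: o_def)
    qed simp
  qed (simp add: h)
  have "compact_space (prod_space n X)"
    using comp by (simp add: compact_space_product_topology)
  then have "compactin euclideanreal (h ` topspace (prod_space n X))"
    using image_compactin[OF _ cont] by (simp only: compact_space_def)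
  then have "bounded (h ` topspace (prod_space n X))"
    by (simp add: compact_imp_bounded)
  then show "h \<in> mspace (C_space (prod_space n X))"
    using cont by (auto simp: h)
qed

lemma mdist_C_space:
  assumes f: "f \<in> mspace (C_space T)" and g: "g \<in> mspace (C_space T)" and ne: "topspace T \<noteq> {}"
  shows "mdist (C_space T) f g = (SUP x\<in>topspace T. \<bar>f x - g x\<bar>)"
proof -
  have le: "mdist (C_space T) f g \<le> a \<longleftrightarrow> (\<forall>x\<in>topspace T. \<bar>f x - g x\<bar> \<le> a)" for a
    using cfunspace_mdist_le[OF f g ne] by (simp add: dist_real_def)
  have up: "\<forall>x\<in>topspace T. \<bar>f x - g x\<bar> \<le> mdist (C_space T) f g"
    using le[of "mdist (C_space T) f g"] by blast
  then have "bdd_above ((\<lambda>x. \<bar>f x - g x\<bar>) ` topspace T)"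
    by (auto intro!: bdd_aboveI2)
  then have "mdist (C_space T) f g \<le> (SUP x\<in>topspace T. \<bar>f x - g x\<bar>)"
    unfolding le by (auto intro: cSUP_upper)
  moreover have "(SUP x\<in>topspace T. \<bar>f x - g x\<bar>) \<le> mdist (C_space T) f g"
    using up ne by (intro cSUP_least) auto
  ultimately show ?thesis by simp
qed

end

theory Submission
  imports Defs
begin

text \<open>
  A functional \<open>f \<mapsto> \<integral> f d\<mu>\<^sub>l\<close> of a minimal cycle has norm at most one and vanishes on sums
  of functions of one coordinate (\<open>annihilating_integral_eq_zero\<close>), so its absolute value at \<open>f\<close>
  is a lower bound for the error.  Let \<open>S\<close> be the supremum of these bounds, or \<open>0\<close> if there is no
  cycle.  The task is to find, for every \<open>\<epsilon> > 0\<close>, a sum of functions of one coordinate that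
  approximates \<open>f\<close> within \<open>S + \<epsilon>\<close>.

  On a finite grid this is linear programming.  By Farkas' lemma, if \<open>f\<close> cannot be
  approximated on the grid within \<open>D \<ge> 0\<close>, there is a vector \<open>c\<close> on the grid, annihilating all
  functions of one coordinate, with \<open>\<Sum>x. c x * f x > D * \<Sum>x. \<bar>c x\<bar>\<close>
  (\<open>finite_uniform_approximation\<close>).  Its support is a projection cycle.  If the cycle is not minimal,
  the vector can be moved along that of a smaller cycle until a coordinate vanishes, or be replaced
  by the latter, without losing the strict inequality (\<open>shrink_support\<close>), and so one arrives at a minimal cycle whose
  normalized functional exceeds \<open>D\<close> at \<open>f\<close> (\<open>minimal_cycle_in_support\<close>).  This is impossible for
  \<open>D = S\<close>, so \<open>f\<close> is approximated within \<open>S\<close> on every grid (\<open>grid_approximation\<close>).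

  Because \<open>X\<close> is a full product, a grid approximation extends to \<open>X\<close> without weak limits of
  measures.  The oscillation \<open>osc i a b = sup \<bar>f (x(i := a)) - f (x(i := b))\<bar>\<close> is a continuous pseudometric
  on \<open>X i\<close>, by compactness of the product.  It provides a finite partition of unity \<open>\<phi> i a\<close> on
  \<open>X i\<close> with centres \<open>a\<close> in a finite set \<open>A i\<close>.  The products of these functions form a partition of unity
  on \<open>X\<close> with centres in the grid, for which averaging over the centres changes \<open>f\<close> by at most
  \<open>\<epsilon>\<close> and turns a sum of functions of one coordinate on the grid into a sum of continuous functions of
  one coordinate (\<open>approximation_from_grid\<close>).
\<close>

section \<open>Linear inequalities and finite uniform approximation\<close>

text \<open>
  A pair \<open>(w, b)\<close> stands for the linear inequality \<open>\<Sum>v. c v * w v \<le> b\<close> in the unknowns \<open>c\<close>, and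
  \<open>row_cone S\<close> consists of the inequalities that arise from those in \<open>S\<close> by addition and by
  multiplication with nonnegative numbers.
\<close>

inductive_set row_cone :: "(('v \<Rightarrow> real) \<times> real) set \<Rightarrow> (('v \<Rightarrow> real) \<times> real) set"
  for S where
  base: "(w, b) \<in> S \<Longrightarrow> (w, b) \<in> row_cone S"
| add: "(w, b) \<in> row_cone S \<Longrightarrow> (w', b') \<in> row_cone S \<Longrightarrow> (\<lambda>v. w v + w' v, b + b') \<in> row_cone S"
| scale: "(w, b) \<in> row_cone S \<Longrightarrow> t \<ge> 0 \<Longrightarrow> (\<lambda>v. t * w v, t * b) \<in> row_cone S"

lemma row_cone_least:
  assumes "S' \<subseteq> row_cone S"
  shows "row_cone S' \<subseteq> row_cone S"
proof safe
  fix w b assume "(w, b) \<in> row_cone S'"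
  then show "(w, b) \<in> row_cone S"
    by induction (use assms in \<open>auto intro: row_cone.intros\<close>)
qed

lemma subset_row_cone: "S \<subseteq> row_cone S"
  by (auto intro: row_cone.base)

lemma row_cone_coeff_zero:
  assumes "(w, b) \<in> row_cone S" "\<And>w b. (w, b) \<in> S \<Longrightarrow> w v = 0"
  shows "w v = 0"
  using assms(1) by induction (use assms(2) in auto)

lemma exists_between_finite_sets:
  fixes L U :: "real set"
  assumes "finite L" "finite U" "\<And>l u. l \<in> L \<Longrightarrow> u \<in> U \<Longrightarrow> l \<le> u"
  shows "\<exists>t. (\<forall>l\<in>L. l \<le> t) \<and> (\<forall>u\<in>U. t \<le> u)"
proof (cases "L = {}")
  case True
  then show ?thesis
    using assms(2) by (intro exI[of _ "if U = {} then 0 else Min U"]) auto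
next
  case False
  then show ?thesis
    using assms by (intro exI[of _ "Max L"]) auto
qed

text \<open>
  Farkas' lemma, by Fourier--Motzkin elimination: a finite system of linear inequalities is solvable
  unless some nonnegative combination of its rows reads \<open>0 \<le> b\<close> with \<open>b < 0\<close>.
\<close>

lemma linear_system_feasible:
  fixes S :: "(('v \<Rightarrow> real) \<times> real) set"
  assumes "finite V" "finite S"
    and "\<And>w b. (w, b) \<in> row_cone S \<Longrightarrow> (\<And>v. v \<in> V \<Longrightarrow> w v = 0) \<Longrightarrow> 0 \<le> b"
  shows "\<exists>c. \<forall>(w, b)\<in>S. (\<Sum>v\<in>V. c v * w v) \<le> b"
  using assms
proof (induction V arbitrary: S rule: finite_induct)
  case empty
  then show ?case by (auto intro: row_cone.base)
next
  case (insert k V)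
  define Z where "Z = {r \<in> S. fst r k = 0}"
  define P where "P = {r \<in> S. fst r k > 0}"
  define N where "N = {r \<in> S. fst r k < 0}"
  define comb :: "('v \<Rightarrow> real) \<times> real \<Rightarrow> ('v \<Rightarrow> real) \<times> real \<Rightarrow> ('v \<Rightarrow> real) \<times> real"
    where "comb p q = (\<lambda>v. fst p k * fst q v + (- fst q k) * fst p v,
                       fst p k * snd q + (- fst q k) * snd p)" for p q
  \<comment> \<open>Eliminate the unknown \<open>k\<close>: keep the rows without it, and combine every upper bound for it with
    every lower bound so that it cancels.\<close>
  define S' where "S' = Z \<union> (\<lambda>(p, q). comb p q) ` (P \<times> N)"
  have fin: "finite S'" "finite P" "finite N"
    using insert.prems(1) by (auto simp: S'_def Z_def P_def N_def)
  have "comb p q \<in> row_cone S" if pq: "p \<in> P" "q \<in> N" for p q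
  proof -
    have "(fst p, snd p) \<in> row_cone S" "(fst q, snd q) \<in> row_cone S"
      using pq subset_row_cone[of S] by (auto simp: P_def N_def)
    moreover have "0 \<le> fst p k" "0 \<le> - fst q k" using pq by (auto simp: P_def N_def)
    ultimately show ?thesis
      unfolding comb_def by (intro row_cone.add row_cone.scale)
  qed
  then have S': "S' \<subseteq> row_cone S"
    by (auto simp: S'_def Z_def intro: row_cone.base)
  have "0 \<le> b" if wb: "(w, b) \<in> row_cone S'" and w: "\<And>v. v \<in> V \<Longrightarrow> w v = 0" for w b
  proof (rule insert.prems(2))
    show "(w, b) \<in> row_cone S" using row_cone_least[OF S'] wb by blast
    have "w k = 0"
      by (rule row_cone_coeff_zero[OF wb]) (auto simp: S'_def Z_def comb_def)
    then show "w v = 0" if "v \<in> insert k V" for v using that w by blast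
  qed
  from insert.IH[OF fin(1) this] obtain c where c: "\<And>w b. (w, b) \<in> S' \<Longrightarrow> (\<Sum>v\<in>V. c v * w v) \<le> b"
    by fastforce
  define val where "val r = (\<Sum>v\<in>V. c v * fst r v)" for r :: "('v \<Rightarrow> real) \<times> real"
  \<comment> \<open>With the other unknowns fixed, row \<open>r\<close> bounds the unknown \<open>k\<close> by \<open>bd r\<close>: from above if \<open>r \<in> P\<close>, from
    below if \<open>r \<in> N\<close>.\<close>
  define bd where "bd r = (snd r - val r) / fst r k" for r :: "('v \<Rightarrow> real) \<times> real"
  have "l \<le> u" if l: "l \<in> bd ` N" and u: "u \<in> bd ` P" for l u
  proof -
    obtain p q where pq: "p \<in> P" "q \<in> N" and lu: "l = bd q" "u = bd p" using l u by blast
    have pos: "fst p k > 0" "- fst q k > 0" using pq by (auto simp: P_def N_def)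
    have "comb p q \<in> S'" using pq by (auto simp: S'_def)
    then have "val (comb p q) \<le> snd (comb p q)"
      using c[of "fst (comb p q)" "snd (comb p q)"] by (simp add: val_def)
    moreover have "val (comb p q) = fst p k * val q + (- fst q k) * val p"
      unfolding val_def comb_def fst_conv sum_distrib_left sum.distrib[symmetric]
      by (intro sum.cong) (auto simp: algebra_simps)
    ultimately have "fst p k * (val q - snd q) \<le> (- fst q k) * (snd p - val p)"
      by (simp add: comb_def algebra_simps)
    then have "(val q - snd q) / (- fst q k) \<le> (snd p - val p) / fst p k"
      using pos by (simp only: pos_divide_le_eq pos_le_divide_eq) (simp add: field_simps)
    moreover have "bd q = (val q - snd q) / (- fst q k)"
      using pos by (simp add: bd_def field_simps)
    ultimately show ?thesis by (simp add: lu bd_def)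
  qed
  then obtain t where t: "\<forall>l\<in>bd ` N. l \<le> t" "\<forall>u\<in>bd ` P. t \<le> u"
    using exists_between_finite_sets[of "bd ` N" "bd ` P"] fin by blast
  have "(\<Sum>v\<in>insert k V. (c(k := t)) v * w v) \<le> b" if wb: "(w, b) \<in> S" for w b
  proof -
    have "(\<Sum>v\<in>V. (c(k := t)) v * w v) = val (w, b)"
      unfolding val_def using insert.hyps by (intro sum.cong) auto
    then have *: "(\<Sum>v\<in>insert k V. (c(k := t)) v * w v) = t * w k + val (w, b)"
      using insert.hyps by simp
    consider "w k = 0" | "w k > 0" | "w k < 0" by linarith
    then have "t * w k + val (w, b) \<le> b"
    proof cases
      case 1
      then have "(w, b) \<in> S'" using wb by (auto simp: S'_def Z_def)
      then show ?thesis using c 1 by (simp add: val_def)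
    next
      case 2
      then have "t \<le> bd (w, b)" using t wb by (auto simp: P_def)
      then show ?thesis using 2 by (simp add: bd_def field_simps)
    next
      case 3
      then have "bd (w, b) \<le> t" using t wb by (auto simp: N_def)
      then show ?thesis using 3 by (simp add: bd_def field_simps)
    qed
    then show ?thesis using * by simp
  qed
  then show ?case by blast
qed

text \<open>
  Duality for uniform approximation on a finite set \<open>Y\<close> by linear combinations of finitely many
  functions \<open>\<lambda>y. h y v\<close>: if every weight \<open>m\<close> on \<open>Y\<close> that is orthogonal to all of them satisfies
  \<open>\<Sum>y. m y * f y \<le> D * \<Sum>y. \<bar>m y\<bar>\<close>, then \<open>f\<close> is approximated within \<open>D\<close>.
\<close>

lemma finite_uniform_approximation:
  fixes h :: "'b \<Rightarrow> 'v \<Rightarrow> real" and f :: "'b \<Rightarrow> real"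
  assumes Y: "finite Y" and V: "finite V" and D: "0 \<le> D"
    and bound: "\<And>m. (\<And>v. v \<in> V \<Longrightarrow> (\<Sum>y\<in>Y. m y * h y v) = 0) \<Longrightarrow>
                  (\<Sum>y\<in>Y. m y * f y) \<le> D * (\<Sum>y\<in>Y. \<bar>m y\<bar>)"
  shows "\<exists>c. \<forall>y\<in>Y. \<bar>f y - (\<Sum>v\<in>V. c v * h y v)\<bar> \<le> D"
proof -
  define S where "S = (\<lambda>y. (h y, f y + D)) ` Y \<union> (\<lambda>y. (\<lambda>v. - h y v, D - f y)) ` Y"
  \<comment> \<open>A nonnegative combination of the rows amounts to a signed weight on \<open>Y\<close>; if both rows of a point
    are used, the signed weights partly cancel, which only decreases \<open>\<Sum>y. \<bar>m y\<bar>\<close>.\<close>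
  have rep: "\<exists>m. (\<forall>v. w v = (\<Sum>y\<in>Y. m y * h y v)) \<and>
                 (\<Sum>y\<in>Y. m y * f y) + D * (\<Sum>y\<in>Y. \<bar>m y\<bar>) \<le> b"
    if "(w, b) \<in> row_cone S" for w b
    using that
  proof induction
    case (base w b)
    then obtain y s where y: "y \<in> Y" "s = 1 \<or> s = -1" "\<forall>v. w v = s * h y v" "b = s * f y + D"
      by (force simp: S_def)
    have "(\<Sum>z\<in>Y. (if z = y then s else 0) * g z) = s * g y" for g :: "'b \<Rightarrow> real"
    proof -
      have "(\<Sum>z\<in>Y. (if z = y then s else 0) * g z) = (\<Sum>z\<in>Y. if z = y then s * g z else 0)"
        by (intro sum.cong) auto
      then show ?thesis using Y y by simp
    qed
    moreover have "(\<Sum>z\<in>Y. \<bar>if z = y then s else 0\<bar>) = 1"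
    proof -
      have "(\<Sum>z\<in>Y. \<bar>if z = y then s else 0\<bar>) = (\<Sum>z\<in>Y. if z = y then 1 else 0)"
        using y by (intro sum.cong) auto
      then show ?thesis using Y y by simp
    qed
    ultimately show ?case
      using y by (intro exI[of _ "\<lambda>z. if z = y then s else 0"]) simp
  next
    case (add w b w' b')
    then obtain m m' where m: "\<And>v. w v = (\<Sum>y\<in>Y. m y * h y v)"
        "(\<Sum>y\<in>Y. m y * f y) + D * (\<Sum>y\<in>Y. \<bar>m y\<bar>) \<le> b"
      and m': "\<And>v. w' v = (\<Sum>y\<in>Y. m' y * h y v)"
        "(\<Sum>y\<in>Y. m' y * f y) + D * (\<Sum>y\<in>Y. \<bar>m' y\<bar>) \<le> b'"
      by blast
    have "(\<Sum>y\<in>Y. \<bar>m y + m' y\<bar>) \<le> (\<Sum>y\<in>Y. \<bar>m y\<bar>) + (\<Sum>y\<in>Y. \<bar>m' y\<bar>)"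
      unfolding sum.distrib[symmetric] by (intro sum_mono) (rule abs_triangle_ineq)
    then have "D * (\<Sum>y\<in>Y. \<bar>m y + m' y\<bar>) \<le> D * (\<Sum>y\<in>Y. \<bar>m y\<bar>) + D * (\<Sum>y\<in>Y. \<bar>m' y\<bar>)"
      using D unfolding distrib_left[symmetric] by (rule mult_left_mono)
    then show ?case
      using m m' by (intro exI[of _ "\<lambda>y. m y + m' y"]) (simp add: distrib_right sum.distrib)
  next
    case (scale w b t)
    then obtain m where m: "\<And>v. w v = (\<Sum>y\<in>Y. m y * h y v)"
        "(\<Sum>y\<in>Y. m y * f y) + D * (\<Sum>y\<in>Y. \<bar>m y\<bar>) \<le> b"
      by blast
    from mult_left_mono[OF m(2) \<open>0 \<le> t\<close>] show ?case
      using m(1) \<open>0 \<le> t\<close>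
      by (intro exI[of _ "\<lambda>y. t * m y"])
         (simp add: abs_mult sum_distrib_left mult.assoc algebra_simps)
  qed
  have "0 \<le> b" if wb: "(w, b) \<in> row_cone S" and w: "\<And>v. v \<in> V \<Longrightarrow> w v = 0" for w b
  proof -
    obtain m where m: "\<And>v. w v = (\<Sum>y\<in>Y. m y * h y v)"
        "(\<Sum>y\<in>Y. m y * f y) + D * (\<Sum>y\<in>Y. \<bar>m y\<bar>) \<le> b"
      using rep[OF wb] by blast
    have "(\<Sum>y\<in>Y. - m y * f y) \<le> D * (\<Sum>y\<in>Y. \<bar>- m y\<bar>)"
      by (rule bound) (use m(1) w in \<open>simp add: sum_negf\<close>)
    then show ?thesis using m(2) by (simp add: sum_negf)
  qed
  moreover have "finite S" using Y by (simp add: S_def)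
  ultimately obtain c where c: "\<forall>(w, b)\<in>S. (\<Sum>v\<in>V. c v * w v) \<le> b"
    using linear_system_feasible[OF V] by blast
  have "\<bar>f y - (\<Sum>v\<in>V. c v * h y v)\<bar> \<le> D" if "y \<in> Y" for y
  proof -
    have "(\<Sum>v\<in>V. c v * h y v) \<le> f y + D" "(\<Sum>v\<in>V. c v * - h y v) \<le> D - f y"
      using c that by (force simp: S_def)+
    then show ?thesis by (simp add: sum_negf abs_le_iff)
  qed
  then show ?thesis by blast
qed

section \<open>From annihilating vectors to minimal cycles\<close>

text \<open>
  A step of reducing the support of a weight \<open>u\<close> with \<open>D * \<Sum>\<bar>u x\<bar> < \<Sum>u x * f x\<close>.  As long as
  \<open>u + t * v\<close> keeps the signs of \<open>u\<close>, the gap between the two sides is affine in \<open>t\<close>, and by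
  assumption nondecreasing; as \<open>v\<close> has somewhere the opposite sign of \<open>u\<close>, one can go on until the
  first coordinate vanishes.
\<close>

lemma shrink_support_along:
  fixes u v f :: "'b \<Rightarrow> real"
  assumes p: "finite p" and u: "\<And>x. x \<in> p \<Longrightarrow> u x \<noteq> 0"
    and cert: "D * (\<Sum>x\<in>p. \<bar>u x\<bar>) < (\<Sum>x\<in>p. u x * f x)"
    and slope: "D * (\<Sum>x\<in>p. sgn (u x) * v x) \<le> (\<Sum>x\<in>p. v x * f x)"
    and opp: "\<exists>x\<in>p. u x * v x < 0"
  shows "\<exists>t. D * (\<Sum>x\<in>p. \<bar>u x + t * v x\<bar>) < (\<Sum>x\<in>p. (u x + t * v x) * f x) \<and>
             (\<exists>x\<in>p. u x + t * v x = 0)"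
proof -
  define q where "q = {x \<in> p. u x * v x < 0}"
  have q: "finite q" "q \<noteq> {}" using p opp by (auto simp: q_def)
  \<comment> \<open>The first time at which a coordinate of \<open>u + t * v\<close> vanishes.\<close>
  define t where "t = Min ((\<lambda>x. \<bar>u x\<bar> / \<bar>v x\<bar>) ` q)"
  have "t \<in> (\<lambda>x. \<bar>u x\<bar> / \<bar>v x\<bar>) ` q"
    unfolding t_def using q by (intro Min_in) auto
  then obtain z where z: "z \<in> q" "t = \<bar>u z\<bar> / \<bar>v z\<bar>" by blast
  have t0: "0 \<le> t" using z by simp
  have le: "t * \<bar>v x\<bar> \<le> \<bar>u x\<bar>" if "x \<in> q" for x
  proof -
    have "t \<le> \<bar>u x\<bar> / \<bar>v x\<bar>" unfolding t_def using q that by (intro Min_le) auto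
    moreover have "v x \<noteq> 0" using that by (auto simp: q_def)
    ultimately show ?thesis by (simp add: pos_le_divide_eq)
  qed
  have "u z + t * v z = 0"
    using z by (auto simp: q_def mult_less_0_iff)
  have abs: "\<bar>u x + t * v x\<bar> = \<bar>u x\<bar> + t * (sgn (u x) * v x)" if x: "x \<in> p" for x
  proof (cases "x \<in> q")
    case True
    then show ?thesis using le[OF True] by (auto simp: q_def mult_less_0_iff)
  next
    case False
    then have "0 \<le> u x * v x" using x by (auto simp: q_def)
    then have "0 \<le> u x * (t * v x)" using t0 by (simp add: mult.left_commute)
    then show ?thesis using u[OF x] by (cases "u x > 0") (auto simp: zero_le_mult_iff sgn_if)
  qed
  have "D * (\<Sum>x\<in>p. \<bar>u x + t * v x\<bar>) = D * (\<Sum>x\<in>p. \<bar>u x\<bar>) + t * (D * (\<Sum>x\<in>p. sgn (u x) * v x))"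
    by (simp add: abs sum.distrib distrib_left sum_distrib_left mult.left_commute)
  also have "\<dots> < (\<Sum>x\<in>p. u x * f x) + t * (\<Sum>x\<in>p. v x * f x)"
    using cert mult_left_mono[OF slope t0] by simp
  also have "\<dots> = (\<Sum>x\<in>p. (u x + t * v x) * f x)"
    by (simp add: sum.distrib distrib_right sum_distrib_left mult.assoc)
  finally show ?thesis using z(1) \<open>u z + t * v z = 0\<close> by (intro exI[of _ t]) (auto simp: q_def)
qed

text \<open>
  If \<open>v\<close> vanishes at some but not at all points of the support of \<open>u\<close>, then some combination of \<open>u\<close>
  and \<open>v\<close> still has a positive gap and vanishes at a point of the support.  Up to the sign of \<open>v\<close>,
  the previous lemma applies, except if \<open>v\<close> nowhere has the opposite sign of \<open>u\<close> and the gap strictly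
  increases in the direction \<open>v\<close>; then \<open>v\<close> itself has a positive gap.
\<close>

lemma shrink_support:
  fixes u v f :: "'b \<Rightarrow> real"
  assumes p: "finite p" and u: "\<And>x. x \<in> p \<Longrightarrow> u x \<noteq> 0"
    and cert: "D * (\<Sum>x\<in>p. \<bar>u x\<bar>) < (\<Sum>x\<in>p. u x * f x)"
    and v: "\<exists>x\<in>p. v x = 0" "\<exists>x\<in>p. v x \<noteq> 0"
  shows "\<exists>s t. D * (\<Sum>x\<in>p. \<bar>s * u x + t * v x\<bar>) < (\<Sum>x\<in>p. (s * u x + t * v x) * f x) \<and>
             (\<exists>x\<in>p. s * u x + t * v x = 0)"
proof -
  \<comment> \<open>The slope at \<open>t = 0\<close> of the gap of \<open>u + t * v\<close>.\<close>
  define sl where "sl v = (\<Sum>x\<in>p. v x * f x) - D * (\<Sum>x\<in>p. sgn (u x) * v x)" for v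
  define good where "good w \<longleftrightarrow>
      D * (\<Sum>x\<in>p. \<bar>w x\<bar>) < (\<Sum>x\<in>p. w x * f x) \<and> (\<exists>x\<in>p. w x = 0)" for w :: "'b \<Rightarrow> real"
  have move: "\<exists>t. good (\<lambda>x. u x + t * v x)" if "0 \<le> sl v" "\<exists>x\<in>p. u x * v x < 0" for v
    unfolding good_def using that by (intro shrink_support_along[OF p u cert]) (auto simp: sl_def)
  have neg: "sl (\<lambda>x. - v x) = - sl v" for v
    by (simp add: sl_def sum_negf)
  have main: "\<exists>s t. good (\<lambda>x. s * u x + t * v x)"
    if sl: "0 \<le> sl v" and v: "\<exists>x\<in>p. v x = 0" "\<exists>x\<in>p. v x \<noteq> 0" for v
  proof (cases "\<exists>x\<in>p. u x * v x < 0")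
    case True
    then obtain t where "good (\<lambda>x. u x + t * v x)" using move[OF sl] by blast
    then show ?thesis by (intro exI[of _ 1] exI[of _ t]) simp
  next
    case False
    then have nn: "0 \<le> u x * v x" if "x \<in> p" for x using that by force
    show ?thesis
    proof (cases "sl v = 0")
      case True
      obtain z where "z \<in> p" "v z \<noteq> 0" using v by blast
      then have "u z * - v z < 0" using nn[of z] u[of z] by (simp add: order_less_le)
      then obtain t where "good (\<lambda>x. u x + t * - v x)"
        using move[of "\<lambda>x. - v x"] True neg[of v] \<open>z \<in> p\<close> by auto
      then show ?thesis by (intro exI[of _ 1] exI[of _ "- t"]) simp
    next
      case False
      have "(\<Sum>x\<in>p. sgn (u x) * v x) = (\<Sum>x\<in>p. \<bar>v x\<bar>)"
      proof (intro sum.cong refl)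
        fix x assume "x \<in> p"
        then show "sgn (u x) * v x = \<bar>v x\<bar>"
          using nn[of x] u[of x] by (auto simp: zero_le_mult_iff sgn_if)
      qed
      then have "good v" using False sl v by (simp add: good_def sl_def)
      then show ?thesis by (intro exI[of _ 0] exI[of _ 1]) simp
    qed
  qed
  show ?thesis
  proof (cases "0 \<le> sl v")
    case True
    from main[OF this v] show ?thesis by (simp add: good_def)
  next
    case False
    then obtain s t where "good (\<lambda>x. s * u x + t * - v x)"
      using main[of "\<lambda>x. - v x"] neg[of v] v by auto
    then show ?thesis unfolding good_def by (intro exI[of _ s] exI[of _ "- t"]) simp
  qed
qed

text \<open>
  The vector \<open>c\<close> on \<open>p\<close> represents a measure \<open>\<Sum>x\<in>p. c x * \<delta>\<^sub>x\<close> all of whose coordinate marginals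
  vanish.  Other than for an associated vector, coordinates of \<open>c\<close> may be zero.
\<close>

definition annihilating ::
    "nat \<Rightarrow> (nat \<Rightarrow> 'a topology) \<Rightarrow> (nat \<Rightarrow> 'a) set \<Rightarrow> ((nat \<Rightarrow> 'a) \<Rightarrow> real) \<Rightarrow> bool" where
  "annihilating n X p c \<longleftrightarrow>
     (\<forall>i\<in>{1..n}. \<forall>a\<in>topspace (X i). (\<Sum>x\<in>p. c x * indicator {x i} a) = 0)"

lemma associated_vector_iff:
  "associated_vector n X p c \<longleftrightarrow> (\<forall>x\<in>p. c x \<noteq> 0) \<and> annihilating n X p c"
  by (simp add: associated_vector_def annihilating_def)

lemma annihilating_iff_on_support:
  assumes "finite p" "q \<subseteq> p" "\<And>x. x \<in> p - q \<Longrightarrow> c x = 0"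
  shows "annihilating n X p c \<longleftrightarrow> annihilating n X q c"
proof -
  have "(\<Sum>x\<in>p. c x * indicator {x i} a) = (\<Sum>x\<in>q. c x * indicator {x i} a)" for i a
    using assms by (intro sum.mono_neutral_right) auto
  then show ?thesis by (simp add: annihilating_def)
qed

lemma annihilating_combine:
  assumes "annihilating n X p c" "annihilating n X p d"
  shows "annihilating n X p (\<lambda>x. s * c x + t * d x)"
  using assms
  by (simp add: annihilating_def distrib_right sum.distrib mult.assoc flip: sum_distrib_left)

text \<open>
  If a functional on a cycle \<open>p\<close> witnesses that \<open>f\<close> cannot be approximated within \<open>D\<close>, then so does
  the functional of some minimal cycle: as long as \<open>p\<close> is not minimal, the associated vector of a
  smaller cycle serves to shrink the support.
\<close>

lemma minimal_cycle_in_support: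
  assumes "finite p" "p \<subseteq> topspace (prod_space n X)" "associated_vector n X p c"
    and "D * (\<Sum>x\<in>p. \<bar>c x\<bar>) < (\<Sum>x\<in>p. c x * f x)"
  shows "\<exists>l d. minimal_projection_cycle n X l \<and> associated_vector n X l d \<and>
           D * (\<Sum>x\<in>l. \<bar>d x\<bar>) < (\<Sum>x\<in>l. d x * f x)"
  using assms
proof (induction p arbitrary: c rule: finite_psubset_induct)
  case (psubset p)
  have "p \<noteq> {}" using psubset.prems(3) by auto
  then have pc: "projection_cycle n X p"
    using psubset by (auto simp: projection_cycle_def)
  show ?case
  proof (cases "minimal_projection_cycle n X p")
    case True
    then show ?thesis using psubset.prems by blast
  next
    case False
    then obtain q where q: "q \<subset> p" "projection_cycle n X q"
      using pc by (auto simp: minimal_projection_cycle_def)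
    then obtain v0 where v0: "associated_vector n X q v0" "q \<noteq> {}"
      by (auto simp: projection_cycle_def)
    define v where "v x = (if x \<in> q then v0 x else 0)" for x
    have "annihilating n X q v"
      using v0 by (simp add: associated_vector_iff annihilating_def v_def)
    then have annv: "annihilating n X p v"
      using annihilating_iff_on_support[of p q v n X] q(1) psubset.hyps by (auto simp: v_def)
    have "\<exists>x\<in>p. v x = 0" "\<exists>x\<in>p. v x \<noteq> 0"
      using q(1) v0 by (auto simp: v_def associated_vector_iff)
    moreover have "\<And>x. x \<in> p \<Longrightarrow> c x \<noteq> 0" and annc: "annihilating n X p c"
      using psubset.prems by (auto simp: associated_vector_iff)
    ultimately obtain s t where st:
      "D * (\<Sum>x\<in>p. \<bar>s * c x + t * v x\<bar>) < (\<Sum>x\<in>p. (s * c x + t * v x) * f x)"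
      "\<exists>x\<in>p. s * c x + t * v x = 0"
      using shrink_support[of p c D f v] psubset.hyps psubset.prems(3) by blast
    define w where "w x = s * c x + t * v x" for x
    define p' where "p' = {x \<in> p. w x \<noteq> 0}"
    have p': "p' \<subset> p" using st(2) by (auto simp: p'_def w_def)
    have sums: "(\<Sum>x\<in>p'. g x) = (\<Sum>x\<in>p. g x)" if "\<And>x. w x = 0 \<Longrightarrow> g x = 0" for g :: "_ \<Rightarrow> real"
      using psubset.hyps that by (intro sum.mono_neutral_left) (auto simp: p'_def)
    have "annihilating n X p w"
      using annihilating_combine[OF annc annv, of s t] by (simp add: w_def[abs_def])
    moreover have "annihilating n X p w \<longleftrightarrow> annihilating n X p' w"
      by (rule annihilating_iff_on_support) (use psubset.hyps in \<open>auto simp: p'_def\<close>)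
    ultimately have "annihilating n X p' w" by blast
    then have "associated_vector n X p' w"
      by (auto simp: associated_vector_iff p'_def)
    moreover have "D * (\<Sum>x\<in>p'. \<bar>w x\<bar>) < (\<Sum>x\<in>p'. w x * f x)"
      using st(1) sums[of "\<lambda>x. \<bar>w x\<bar>"] sums[of "\<lambda>x. w x * f x"] by (simp add: w_def)
    ultimately show ?thesis
      using psubset.IH[OF p'] p' psubset.prems(1) by blast
  qed
qed

text \<open>
  The upper estimate on a finite grid \<open>A 1 \<times> \<dots> \<times> A n\<close>.  The sums of functions of one coordinate are
  the linear combinations of the indicators of the sets \<open>{y. y i = a}\<close>, and the weights orthogonal
  to these indicators are the annihilating vectors.
\<close>

lemma grid_approximation:
  assumes A: "\<And>i. i \<in> {1..n} \<Longrightarrow> finite (A i)" "\<And>i. i \<in> {1..n} \<Longrightarrow> A i \<subseteq> topspace (X i)"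
    and D: "0 \<le> D"
    and bound: "\<And>l c. minimal_projection_cycle n X l \<Longrightarrow> associated_vector n X l c \<Longrightarrow>
                  (\<Sum>x\<in>l. c x * f x) \<le> D * (\<Sum>x\<in>l. \<bar>c x\<bar>)"
  shows "\<exists>u. \<forall>y\<in>PiE {1..n} A. \<bar>f y - (\<Sum>i=1..n. u i (y i))\<bar> \<le> D"
proof -
  define Y where "Y = PiE {1..n} A"
  have Y: "finite Y" unfolding Y_def using A by (intro finite_PiE) auto
  have Ysub: "Y \<subseteq> topspace (prod_space n X)"
    using A(2) by (auto simp: Y_def PiE_iff) (meson atLeastAtMost_iff One_nat_def subsetD)
  define V where "V = Sigma {1..n} A"
  have V: "finite V" using A by (auto simp: V_def)
  define h :: "(nat \<Rightarrow> 'a) \<Rightarrow> nat \<times> 'a \<Rightarrow> real" where "h y v = indicator {y (fst v)} (snd v)" for y v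
  have "\<exists>c. \<forall>y\<in>Y. \<bar>f y - (\<Sum>v\<in>V. c v * h y v)\<bar> \<le> D"
  proof (rule finite_uniform_approximation[OF Y V D], rule ccontr)
    fix m assume m: "\<And>v. v \<in> V \<Longrightarrow> (\<Sum>y\<in>Y. m y * h y v) = 0"
      and *: "\<not> (\<Sum>y\<in>Y. m y * f y) \<le> D * (\<Sum>y\<in>Y. \<bar>m y\<bar>)"
    define p where "p = {y \<in> Y. m y \<noteq> 0}"
    have sums: "(\<Sum>x\<in>p. g x) = (\<Sum>x\<in>Y. g x)" if "\<And>x. m x = 0 \<Longrightarrow> g x = 0" for g :: "_ \<Rightarrow> real"
      using Y that by (intro sum.mono_neutral_left) (auto simp: p_def)
    have "annihilating n X Y m"
      unfolding annihilating_def
    proof (intro ballI)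
      fix i a assume i: "i \<in> {1..n}"
      show "(\<Sum>x\<in>Y. m x * indicator {x i} a) = 0"
      proof (cases "a \<in> A i")
        case True
        then show ?thesis using m[of "(i, a)"] i by (simp add: V_def h_def)
      next
        case False
        then have "a \<noteq> x i" if "x \<in> Y" for x using that i by (auto simp: Y_def)
        then show ?thesis by (intro sum.neutral) auto
      qed
    qed
    moreover have "annihilating n X Y m \<longleftrightarrow> annihilating n X p m"
      by (rule annihilating_iff_on_support) (use Y in \<open>auto simp: p_def\<close>)
    ultimately have "annihilating n X p m" by blast
    then have "associated_vector n X p m" by (auto simp: associated_vector_iff p_def)
    moreover have "D * (\<Sum>x\<in>p. \<bar>m x\<bar>) < (\<Sum>x\<in>p. m x * f x)"
      using * sums[of "\<lambda>x. \<bar>m x\<bar>"] sums[of "\<lambda>x. m x * f x"] by simp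
    moreover have "finite p" "p \<subseteq> topspace (prod_space n X)"
      using Y Ysub by (auto simp: p_def)
    ultimately obtain l d where "minimal_projection_cycle n X l" "associated_vector n X l d"
        "D * (\<Sum>x\<in>l. \<bar>d x\<bar>) < (\<Sum>x\<in>l. d x * f x)"
      using minimal_cycle_in_support by blast
    then show False using bound[of l d] by simp
  qed
  then obtain c where c: "\<And>y. y \<in> Y \<Longrightarrow> \<bar>f y - (\<Sum>v\<in>V. c v * h y v)\<bar> \<le> D" by blast
  have eq: "(\<Sum>v\<in>V. c v * h y v) = (\<Sum>i=1..n. c (i, y i))" if y: "y \<in> Y" for y
  proof -
    have "(\<Sum>v\<in>V. c v * h y v) = (\<Sum>i=1..n. \<Sum>a\<in>A i. c (i, a) * indicator {y i} a)"
      unfolding V_def h_def using A(1) by (subst sum.Sigma) (auto simp: case_prod_unfold)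
    also have "\<dots> = (\<Sum>i=1..n. c (i, y i))"
    proof (intro sum.cong refl)
      fix i assume i: "i \<in> {1..n}"
      have "(\<Sum>a\<in>A i. c (i, a) * indicator {y i} a) = (\<Sum>a\<in>A i. if a = y i then c (i, a) else 0)"
        by (intro sum.cong) (auto simp: indicator_def)
      also have "\<dots> = c (i, y i)"
        using A(1)[OF i] y i by (auto simp: Y_def PiE_iff)
      finally show "(\<Sum>a\<in>A i. c (i, a) * indicator {y i} a) = c (i, y i)" .
    qed
    finally show ?thesis .
  qed
  have "\<bar>f y - (\<Sum>i=1..n. c (i, y i))\<bar> \<le> D" if "y \<in> Y" for y
    using c[OF that] unfolding eq[OF that] .
  then show ?thesis
    unfolding Y_def by (intro exI[of _ "\<lambda>i a. c (i, a)"] ballI)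
qed

section \<open>Extending approximations from finite grids\<close>

context
  fixes I :: "'i set" and X :: "'i \<Rightarrow> 'a topology" and f :: "('i \<Rightarrow> 'a) \<Rightarrow> real"
  assumes finite_I: "finite I"
    and nonempty: "\<And>i. i \<in> I \<Longrightarrow> topspace (X i) \<noteq> {}"
    and compact: "\<And>i. i \<in> I \<Longrightarrow> compact_space (X i)"
    and cont: "continuous_map (product_topology X I) euclideanreal f"
begin

text \<open>
  The pseudometric on the \<open>i\<close>-th factor given by the uniform distance between the functions that arise
  from \<open>f\<close> by fixing the \<open>i\<close>-th coordinate.
\<close>

definition osc :: "'i \<Rightarrow> 'a \<Rightarrow> 'a \<Rightarrow> real" where
  "osc i a b = (SUP x\<in>topspace (product_topology X I). \<bar>f (x(i := a)) - f (x(i := b))\<bar>)"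

lemma product_nonempty: "topspace (product_topology X I) \<noteq> {}"
  using nonempty by (simp add: PiE_eq_empty_iff)

lemma update_in_product:
  "x \<in> topspace (product_topology X I) \<Longrightarrow> i \<in> I \<Longrightarrow> a \<in> topspace (X i) \<Longrightarrow>
     x(i := a) \<in> topspace (product_topology X I)"
  by (auto simp: PiE_iff extensional_def)

lemma compact_product: "compact_space (product_topology X I)"
  using compact by (simp add: compact_space_product_topology)

lemma bounded_on_product: "\<exists>B. \<forall>x\<in>topspace (product_topology X I). \<bar>f x\<bar> \<le> B"
proof -
  have "compactin euclideanreal (f ` topspace (product_topology X I))"
    using image_compactin[OF _ cont] compact_product by (simp only: compact_space_def)
  then have "bounded (f ` topspace (product_topology X I))"
    by (simp add: compact_imp_bounded)
  then show ?thesis by (auto simp: bounded_iff)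
qed

lemma osc_upper:
  assumes "x \<in> topspace (product_topology X I)" "i \<in> I" "a \<in> topspace (X i)" "b \<in> topspace (X i)"
  shows "\<bar>f (x(i := a)) - f (x(i := b))\<bar> \<le> osc i a b"
  unfolding osc_def
proof (rule cSUP_upper[OF assms(1)])
  obtain B where B: "\<And>x. x \<in> topspace (product_topology X I) \<Longrightarrow> \<bar>f x\<bar> \<le> B"
    using bounded_on_product by blast
  show "bdd_above ((\<lambda>x. \<bar>f (x(i := a)) - f (x(i := b))\<bar>) ` topspace (product_topology X I))"
  proof (rule bdd_aboveI2)
    fix x assume "x \<in> topspace (product_topology X I)"
    then show "\<bar>f (x(i := a)) - f (x(i := b))\<bar> \<le> 2 * B"
      using B[OF update_in_product[of x i a]] B[OF update_in_product[of x i b]] assms by linarith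
  qed
qed

lemma osc_least:
  assumes "\<And>x. x \<in> topspace (product_topology X I) \<Longrightarrow> \<bar>f (x(i := a)) - f (x(i := b))\<bar> \<le> e"
  shows "osc i a b \<le> e"
  unfolding osc_def using product_nonempty assms by (rule cSUP_least)

lemma osc_commute: "osc i a b = osc i b a"
  by (simp add: osc_def abs_minus_commute)

lemma osc_triangle:
  assumes "i \<in> I" "a \<in> topspace (X i)" "b \<in> topspace (X i)" "c \<in> topspace (X i)"
  shows "osc i a c \<le> osc i a b + osc i b c"
proof (rule osc_least)
  fix x assume "x \<in> topspace (product_topology X I)"
  then show "\<bar>f (x(i := a)) - f (x(i := c))\<bar> \<le> osc i a b + osc i b c"
    using osc_upper[of x i a b] osc_upper[of x i b c] assms by linarith
qed

text \<open>
  By the tube lemma, the topology of \<open>X i\<close> is at least as fine as that of the pseudometric \<open>osc i\<close>.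
\<close>

lemma osc_neighbourhood:
  assumes i: "i \<in> I" and a: "a \<in> topspace (X i)" and e: "0 < e"
  shows "\<exists>U. openin (X i) U \<and> a \<in> U \<and> (\<forall>b\<in>U. osc i a b < e)"
proof -
  let ?P = "product_topology X I"
  define Q where "Q = prod_topology (X i) ?P"
  define W where "W = {z \<in> topspace Q. \<bar>f ((snd z)(i := a)) - f ((snd z)(i := fst z))\<bar> \<in> {..<e / 2}}"
  have "continuous_map Q ?P (\<lambda>z. (snd z)(i := a))"
    unfolding continuous_map_componentwise
  proof safe
    fix z assume "z \<in> topspace Q"
    then show "(snd z)(i := a) \<in> extensional I"
      using i by (auto simp: Q_def PiE_iff extensional_def)
  next
    fix k assume k: "k \<in> I"
    have "continuous_map Q (X k) (\<lambda>z. (snd z) k)"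
      using continuous_map_compose[OF continuous_map_snd[of "X i" ?P] continuous_map_product_projection[OF k]]
      by (simp add: Q_def o_def)
    then show "continuous_map Q (X k) (\<lambda>z. ((snd z)(i := a)) k)"
      using a by (cases "k = i") auto
  qed
  moreover have "continuous_map Q ?P (\<lambda>z. (snd z)(i := fst z))"
    unfolding continuous_map_componentwise
  proof safe
    fix z assume "z \<in> topspace Q"
    then show "(snd z)(i := fst z) \<in> extensional I"
      using i by (auto simp: Q_def PiE_iff extensional_def)
  next
    fix k assume k: "k \<in> I"
    have "continuous_map Q (X k) (\<lambda>z. (snd z) k)"
      using continuous_map_compose[OF continuous_map_snd[of "X i" ?P] continuous_map_product_projection[OF k]]
      by (simp add: Q_def o_def)
    then show "continuous_map Q (X k) (\<lambda>z. ((snd z)(i := fst z)) k)"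
      by (cases "k = i") (auto simp: Q_def continuous_map_fst)
  qed
  ultimately have "continuous_map Q euclideanreal (\<lambda>z. \<bar>f ((snd z)(i := a)) - f ((snd z)(i := fst z))\<bar>)"
    using continuous_map_compose[OF _ cont, of Q]
    by (intro continuous_map_real_abs continuous_map_diff) (simp_all add: o_def)
  then have W: "openin Q W"
    unfolding W_def by (rule openin_continuous_map_preimage) (simp flip: open_openin)
  have "{a} \<times> topspace ?P \<subseteq> W"
    using a e by (auto simp: W_def Q_def)
  then obtain U V where U: "openin (X i) U" "a \<in> U" "topspace ?P \<subseteq> V" "U \<times> V \<subseteq> W"
    using tube_lemma_right[OF W[unfolded Q_def], of "topspace ?P" a] compact_product a
    unfolding compact_space_def by blast
  have "osc i a b < e" if "b \<in> U" for b
  proof -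
    have "osc i a b \<le> e / 2"
    proof (rule osc_least)
      fix x assume "x \<in> topspace ?P"
      then have "(b, x) \<in> W" using U that by blast
      then show "\<bar>f (x(i := a)) - f (x(i := b))\<bar> \<le> e / 2" by (simp add: W_def)
    qed
    then show ?thesis using e by simp
  qed
  then show ?thesis using U by blast
qed

lemma continuous_osc:
  assumes i: "i \<in> I" and a: "a \<in> topspace (X i)"
  shows "continuous_map (X i) euclideanreal (osc i a)"
proof -
  have "\<exists>U. openin (X i) U \<and> b \<in> U \<and> (\<forall>b'\<in>U. dist (osc i a b) (osc i a b') < e)"
    if b: "b \<in> topspace (X i)" and e: "0 < e" for b e
  proof -
    obtain U where U: "openin (X i) U" "b \<in> U" "\<And>b'. b' \<in> U \<Longrightarrow> osc i b b' < e"
      using osc_neighbourhood[OF i b e] by blast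
    have "dist (osc i a b) (osc i a b') < e" if "b' \<in> U" for b'
    proof -
      have b': "b' \<in> topspace (X i)" using U(1) that openin_subset by blast
      show ?thesis
        using osc_triangle[OF i a b b'] osc_triangle[OF i a b' b] U(3)[OF that] osc_commute[of i b b']
        by (simp add: dist_real_def)
    qed
    then show ?thesis using U by blast
  qed
  then have "continuous_map (X i) Met_TC.mtopology (osc i a)"
    unfolding Met_TC.continuous_map_to_metric by (auto simp: dist_commute)
  then show ?thesis by simp
qed

text \<open>
  Change one coordinate after the other.
\<close>

lemma osc_telescope:
  assumes x: "x \<in> topspace (product_topology X I)" and y: "y \<in> topspace (product_topology X I)"
  shows "\<bar>f x - f y\<bar> \<le> (\<Sum>i\<in>I. osc i (x i) (y i))"
proof -
  have "\<bar>f x - f (override_on x y J)\<bar> \<le> (\<Sum>i\<in>J. osc i (x i) (y i))" if "J \<subseteq> I" for J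
    using finite_subset[OF that finite_I] that
  proof (induction J rule: finite_induct)
    case empty
    then show ?case by simp
  next
    case (insert k J)
    define z where "z = override_on x y J"
    have k: "k \<in> I" "x k \<in> topspace (X k)" "y k \<in> topspace (X k)"
      using insert.prems x y by auto
    have z: "z \<in> topspace (product_topology X I)"
      using x y insert.prems by (auto simp: z_def override_on_def PiE_iff extensional_def)
    have "z(k := x k) = z" "z(k := y k) = override_on x y (insert k J)"
      using insert.hyps by (auto simp: z_def override_on_def fun_eq_iff)
    then have "\<bar>f z - f (override_on x y (insert k J))\<bar> \<le> osc k (x k) (y k)"
      using osc_upper[OF z k] by simp
    moreover have "\<bar>f x - f z\<bar> \<le> (\<Sum>i\<in>J. osc i (x i) (y i))"
      using insert.IH insert.prems by (simp add: z_def)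
    ultimately show ?case using insert.hyps by simp
  qed
  from this[of I] have "\<bar>f x - f (override_on x y I)\<bar> \<le> (\<Sum>i\<in>I. osc i (x i) (y i))" by simp
  moreover have "override_on x y I = y"
    using x y by (auto simp: override_on_def fun_eq_iff PiE_iff extensional_def)
  ultimately show ?thesis by simp
qed

text \<open>
  A partition of unity on \<open>X i\<close> into functions \<open>\<phi> a\<close> supported near their centres \<open>a\<close>.  It is built
  from the pseudometric \<open>osc i\<close> itself rather than from Urysohn functions.
\<close>

lemma osc_partition_of_unity:
  assumes i: "i \<in> I" and e: "0 < e"
  shows "\<exists>A \<phi>. finite A \<and> A \<subseteq> topspace (X i) \<and>
           (\<forall>a\<in>A. continuous_map (X i) euclideanreal (\<phi> a)) \<and>
           (\<forall>b\<in>topspace (X i). (\<Sum>a\<in>A. \<phi> a b) = 1 \<and>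
              (\<forall>a\<in>A. 0 \<le> \<phi> a b \<and> (\<phi> a b \<noteq> 0 \<longrightarrow> osc i b a < e)))"
proof -
  obtain U where U: "\<And>a. a \<in> topspace (X i) \<Longrightarrow>
      openin (X i) (U a) \<and> a \<in> U a \<and> (\<forall>b\<in>U a. osc i a b < e)"
    using osc_neighbourhood[OF i _ e] by metis
  have "\<exists>F. finite F \<and> F \<subseteq> U ` topspace (X i) \<and> topspace (X i) \<subseteq> \<Union>F"
    using compact[OF i, unfolded compact_space_alt, rule_format, of "U ` topspace (X i)"] U by blast
  then obtain A where A: "finite A" "A \<subseteq> topspace (X i)" "topspace (X i) \<subseteq> \<Union>(U ` A)"
    by (metis finite_subset_image)
  define \<psi> where "\<psi> a b = max 0 (e - osc i a b)" for a b
  define s where "s b = (\<Sum>a\<in>A. \<psi> a b)" for b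
  have cont_\<psi>: "continuous_map (X i) euclideanreal (\<psi> a)" if "a \<in> A" for a
    unfolding \<psi>_def[abs_def] using A(2) that
    by (intro continuous_map_real_max continuous_map_diff continuous_osc i) auto
  have s: "0 < s b" if b: "b \<in> topspace (X i)" for b
  proof -
    obtain a where a: "a \<in> A" "b \<in> U a" using A b by blast
    then have "0 < \<psi> a b" using U A(2) by (force simp: \<psi>_def)
    then show ?thesis
      unfolding s_def using A(1) a(1) by (intro sum_pos2[of _ a]) (auto simp: \<psi>_def)
  qed
  have cont_s: "continuous_map (X i) euclideanreal s"
    unfolding s_def[abs_def] using A(1) cont_\<psi> by (intro continuous_map_sum) auto
  show ?thesis
  proof (intro exI[of _ A] exI[of _ "\<lambda>a b. \<psi> a b / s b"] conjI ballI impI)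
    fix a assume a: "a \<in> A"
    show "continuous_map (X i) euclideanreal (\<lambda>b. \<psi> a b / s b)"
      using cont_\<psi>[OF a] cont_s s by (intro continuous_map_real_divide) force+
  next
    fix b assume b: "b \<in> topspace (X i)"
    show "(\<Sum>a\<in>A. \<psi> a b / s b) = 1"
      using s[OF b] by (simp add: s_def flip: sum_divide_distrib)
    fix a assume a: "a \<in> A"
    show "0 \<le> \<psi> a b / s b" using s[OF b] by (simp add: \<psi>_def)
    show "osc i b a < e" if "\<psi> a b / s b \<noteq> 0"
      using that osc_commute[of i b a] by (auto simp: \<psi>_def max_def split: if_splits)
  qed (use A in auto)
qed

text \<open>
  An approximation \<open>\<Sum>i. u i\<close> of \<open>f\<close> on a suitable finite grid extends to the whole product with
  almost the same error.  The extension is \<open>g i b = \<Sum>a. \<phi> i a b * u i a\<close>; at each point \<open>x\<close>, both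
  \<open>f x\<close> and \<open>\<Sum>i. g i (x i)\<close> are, the former up to a small error, averages of the corresponding values
  at grid points near \<open>x\<close>, with the same weights \<open>w y = \<Prod>i. \<phi> i (y i) (x i)\<close>.
\<close>

lemma approximation_from_grid:
  assumes e: "0 < e"
  shows "\<exists>A. (\<forall>i\<in>I. finite (A i) \<and> A i \<subseteq> topspace (X i)) \<and>
    (\<forall>u D. (\<forall>y\<in>PiE I A. \<bar>f y - (\<Sum>i\<in>I. u i (y i))\<bar> \<le> D) \<longrightarrow>
      (\<exists>g. (\<forall>i\<in>I. continuous_map (X i) euclideanreal (g i)) \<and>
           (\<forall>x\<in>topspace (product_topology X I). \<bar>f x - (\<Sum>i\<in>I. g i (x i))\<bar> \<le> D + real (card I) * e)))"
proof -
  have "\<forall>i\<in>I. \<exists>A \<phi>. finite A \<and> A \<subseteq> topspace (X i) \<and>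
           (\<forall>a\<in>A. continuous_map (X i) euclideanreal (\<phi> a)) \<and>
           (\<forall>b\<in>topspace (X i). (\<Sum>a\<in>A. \<phi> a b) = 1 \<and>
              (\<forall>a\<in>A. 0 \<le> \<phi> a b \<and> (\<phi> a b \<noteq> 0 \<longrightarrow> osc i b a < e)))"
    using osc_partition_of_unity[OF _ e] by blast
  then obtain A \<phi> where A: "\<And>i. i \<in> I \<Longrightarrow> finite (A i) \<and> A i \<subseteq> topspace (X i) \<and>
           (\<forall>a\<in>A i. continuous_map (X i) euclideanreal (\<phi> i a)) \<and>
           (\<forall>b\<in>topspace (X i). (\<Sum>a\<in>A i. \<phi> i a b) = 1 \<and>
              (\<forall>a\<in>A i. 0 \<le> \<phi> i a b \<and> (\<phi> i a b \<noteq> 0 \<longrightarrow> osc i b a < e)))"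
    by metis
  have "\<exists>g. (\<forall>i\<in>I. continuous_map (X i) euclideanreal (g i)) \<and>
           (\<forall>x\<in>topspace (product_topology X I). \<bar>f x - (\<Sum>i\<in>I. g i (x i))\<bar> \<le> D + real (card I) * e)"
    if u: "\<forall>y\<in>PiE I A. \<bar>f y - (\<Sum>i\<in>I. u i (y i))\<bar> \<le> D" for u D
  proof -
    define g where "g i b = (\<Sum>a\<in>A i. \<phi> i a b * u i a)" for i b
    have "continuous_map (X i) euclideanreal (g i)" if "i \<in> I" for i
      unfolding g_def[abs_def] using A[OF that]
      by (intro continuous_map_sum continuous_map_real_mult_right) auto
    moreover have "\<bar>f x - (\<Sum>i\<in>I. g i (x i))\<bar> \<le> D + real (card I) * e"
      if x: "x \<in> topspace (product_topology X I)" for x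
    proof -
      define w where "w y = (\<Prod>i\<in>I. \<phi> i (y i) (x i))" for y
      have xi: "x i \<in> topspace (X i)" if "i \<in> I" for i using x that by auto
      have finA: "finite (A i)" if "i \<in> I" for i using A that by blast
      have w0: "0 \<le> w y" if "y \<in> PiE I A" for y
        unfolding w_def using that A xi by (intro prod_nonneg) (auto simp: PiE_iff)
      have w1: "(\<Sum>y\<in>PiE I A. w y) = 1"
      proof -
        have "(\<Sum>y\<in>PiE I A. w y) = (\<Prod>i\<in>I. \<Sum>a\<in>A i. \<phi> i a (x i))"
          unfolding w_def by (rule prod_sum_PiE[symmetric]) (use finite_I finA in auto)
        also have "\<dots> = 1" using A xi by (intro prod.neutral) blast
        finally show ?thesis .
      qed
      have marginal: "(\<Sum>y\<in>PiE I A. w y * u i (y i)) = g i (x i)" if i: "i \<in> I" for i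
      proof -
        have "w y * u i (y i) = (\<Prod>j\<in>I. \<phi> j (y j) (x j) * (if j = i then u i (y j) else 1))" for y
          using finite_I i by (simp add: w_def prod.distrib)
        then have "(\<Sum>y\<in>PiE I A. w y * u i (y i)) =
            (\<Prod>j\<in>I. \<Sum>a\<in>A j. \<phi> j a (x j) * (if j = i then u i a else 1))"
          using finite_I finA by (simp only:) (rule prod_sum_PiE[symmetric])
        also have "\<dots> = (\<Prod>j\<in>I. if j = i then g i (x i) else 1)"
          using A xi by (intro prod.cong) (auto simp: g_def)
        also have "\<dots> = g i (x i)" using finite_I i by simp
        finally show ?thesis .
      qed
      have "(\<Sum>i\<in>I. g i (x i)) = (\<Sum>y\<in>PiE I A. w y * (\<Sum>i\<in>I. u i (y i)))"
        unfolding sum_distrib_left by (subst sum.swap) (simp add: marginal)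
      moreover have "f x = (\<Sum>y\<in>PiE I A. w y * f x)"
        using w1 by (simp flip: sum_distrib_right)
      ultimately have "f x - (\<Sum>i\<in>I. g i (x i)) = (\<Sum>y\<in>PiE I A. w y * (f x - (\<Sum>i\<in>I. u i (y i))))"
        by (simp add: right_diff_distrib sum_subtractf)
      then have "\<bar>f x - (\<Sum>i\<in>I. g i (x i))\<bar> \<le> (\<Sum>y\<in>PiE I A. \<bar>w y * (f x - (\<Sum>i\<in>I. u i (y i)))\<bar>)"
        by simp
      also have "\<dots> \<le> (\<Sum>y\<in>PiE I A. w y * (D + real (card I) * e))"
      proof (rule sum_mono)
        fix y assume y: "y \<in> PiE I A"
        show "\<bar>w y * (f x - (\<Sum>i\<in>I. u i (y i)))\<bar> \<le> w y * (D + real (card I) * e)"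
        proof (cases "w y = 0")
          case False
          have "osc i (x i) (y i) < e" if i: "i \<in> I" for i
          proof -
            have "\<phi> i (y i) (x i) \<noteq> 0" using False i finite_I by (auto simp: w_def)
            then show ?thesis using A[OF i] xi[OF i] y i by (auto simp: PiE_iff)
          qed
          then have "(\<Sum>i\<in>I. osc i (x i) (y i)) \<le> real (card I) * e"
            by (intro sum_bounded_above) force
          moreover have "y \<in> topspace (product_topology X I)"
            using y A unfolding topspace_product_topology PiE_iff by blast
          ultimately have "\<bar>f x - f y\<bar> \<le> real (card I) * e"
            using osc_telescope[OF x] by force
          then have "\<bar>f x - (\<Sum>i\<in>I. u i (y i))\<bar> \<le> D + real (card I) * e"
            using u y by force
          then show ?thesis
            using w0[OF y] by (simp add: abs_mult mult_left_mono)
        qed simp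
      qed
      also have "\<dots> = D + real (card I) * e"
        using w1 by (simp flip: sum_distrib_right)
      finally show ?thesis .
    qed
    ultimately show ?thesis by blast
  qed
  moreover have "\<forall>i\<in>I. finite (A i) \<and> A i \<subseteq> topspace (X i)" using A by blast
  ultimately show ?thesis by (intro exI[of _ A] conjI allI impI)
qed

end

section \<open>The error of approximation\<close>

text \<open>
  Group the points of \<open>p\<close> by their \<open>i\<close>-th coordinate.
\<close>

lemma annihilating_integral_eq_zero:
  assumes p: "finite p" "p \<subseteq> topspace (prod_space n X)"
    and c: "annihilating n X p c" and i: "i \<in> {1..n}"
  shows "(\<Sum>x\<in>p. c x * g (x i)) = 0"
proof -
  have "(\<Sum>x\<in>p. c x * g (x i)) =
      (\<Sum>x\<in>p. \<Sum>a\<in>(\<lambda>x. x i) ` p. g a * (c x * indicator {x i} a))"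
  proof (intro sum.cong refl)
    fix x assume x: "x \<in> p"
    have "(\<Sum>a\<in>(\<lambda>x. x i) ` p. g a * (c x * indicator {x i} a)) =
        (\<Sum>a\<in>(\<lambda>x. x i) ` p. if a = x i then c x * g a else 0)"
      by (intro sum.cong) (auto simp: indicator_def)
    also have "\<dots> = c x * g (x i)" using p x by simp
    finally show "c x * g (x i) = (\<Sum>a\<in>(\<lambda>x. x i) ` p. g a * (c x * indicator {x i} a))" by simp
  qed
  also have "\<dots> = (\<Sum>a\<in>(\<lambda>x. x i) ` p. g a * (\<Sum>x\<in>p. c x * indicator {x i} a))"
    unfolding sum_distrib_left by (rule sum.swap)
  also have "\<dots> = 0"
  proof (intro sum.neutral ballI)
    fix a assume "a \<in> (\<lambda>x. x i) ` p"
    then have "a \<in> topspace (X i)" using p(2) i by (auto simp: PiE_iff)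
    then show "g a * (\<Sum>x\<in>p. c x * indicator {x i} a) = 0"
      using c i by (simp add: annihilating_def)
  qed
  finally show ?thesis .
qed

lemma cycle_sum_le:
  assumes p: "finite p" "p \<subseteq> topspace (prod_space n X)" and c: "annihilating n X p c"
    and le: "\<And>x. x \<in> topspace (prod_space n X) \<Longrightarrow> \<bar>f x - (\<Sum>i=1..n. g i (x i))\<bar> \<le> D"
  shows "\<bar>\<Sum>x\<in>p. c x * f x\<bar> \<le> D * (\<Sum>x\<in>p. \<bar>c x\<bar>)"
proof -
  have "(\<Sum>x\<in>p. c x * (\<Sum>i=1..n. g i (x i))) = (\<Sum>i=1..n. \<Sum>x\<in>p. c x * g i (x i))"
    unfolding sum_distrib_left by (rule sum.swap)
  also have "\<dots> = 0"
    using annihilating_integral_eq_zero[OF p c] by (intro sum.neutral) blast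
  finally have "(\<Sum>x\<in>p. c x * f x) = (\<Sum>x\<in>p. c x * (f x - (\<Sum>i=1..n. g i (x i))))"
    by (simp add: right_diff_distrib sum_subtractf)
  then have "\<bar>\<Sum>x\<in>p. c x * f x\<bar> \<le> (\<Sum>x\<in>p. \<bar>c x * (f x - (\<Sum>i=1..n. g i (x i)))\<bar>)"
    by simp
  also have "\<dots> \<le> (\<Sum>x\<in>p. \<bar>c x\<bar> * D)"
    using le p(2) unfolding abs_mult by (intro sum_mono mult_left_mono) auto
  finally show ?thesis by (simp add: sum_distrib_left mult.commute)
qed

lemma abs_cycle_integral:
  assumes l: "minimal_projection_cycle n X l" and c: "associated_vector n X l c"
    and f: "continuous_map (prod_space n X) euclideanreal f"
  shows "\<bar>\<Sum>x\<in>l. c x * f x\<bar> = \<bar>cycle_integral n X l f\<bar> * (\<Sum>x\<in>l. \<bar>c x\<bar>)"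
proof -
  have l': "finite l" "l \<noteq> {}" "l \<subseteq> topspace (prod_space n X)"
    using l by (auto simp: minimal_projection_cycle_def projection_cycle_def)
  define s where "s = (\<Sum>x\<in>l. \<bar>c x\<bar>)"
  have s: "0 < s"
    unfolding s_def using l' c by (intro sum_pos) (auto simp: associated_vector_def)
  have "(\<Sum>x\<in>l. \<bar>1 / s * c x\<bar>) = 1"
    using s by (simp add: abs_mult s_def flip: sum_divide_distrib)
  then have "normalized_vector n X l (\<lambda>x. 1 / s * c x)"
    using associated_vector_scale[OF c, of "1 / s"] s by (simp add: normalized_vector_def)
  from abs_cycle_integral_eq[OF l this, of f]
  have "\<bar>cycle_integral n X l f\<bar> = \<bar>\<Sum>x\<in>l. 1 / s * c x * f x\<bar>"
    using point_mass_integral_eq[OF l'(3) f] by simp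
  also have "\<dots> = \<bar>\<Sum>x\<in>l. c x * f x\<bar> / s"
    using s by (simp add: abs_divide flip: sum_divide_distrib)
  finally show ?thesis using s by (simp add: s_def)
qed

theorem theorem2p8:
  fixes n :: nat and X :: "nat \<Rightarrow> 'a topology" and f :: "(nat \<Rightarrow> 'a) \<Rightarrow> real"
  assumes "n \<ge> 1"
    and "\<And>i. i \<in> {1..n} \<Longrightarrow> topspace (X i) \<noteq> {}"
    and "\<And>i. i \<in> {1..n} \<Longrightarrow> compact_space (X i)"
    and "\<And>i. i \<in> {1..n} \<Longrightarrow> Hausdorff_space (X i)"
    and "f \<in> mspace (C_space (prod_space n X))"
  shows "approx_error n X f =
    (if \<exists>l. minimal_projection_cycle n X l
     then SUP l\<in>{l. minimal_projection_cycle n X l}. \<bar>cycle_integral n X l f\<bar>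
     else 0)"
proof -
  let ?P = "prod_space n X"
  define M where "M = sum_functions n X"
  define E where "E = approx_error n X f"
  define S where "S = (if \<exists>l. minimal_projection_cycle n X l
     then SUP l\<in>{l. minimal_projection_cycle n X l}. \<bar>cycle_integral n X l f\<bar> else 0)"
  have cont: "continuous_map ?P euclideanreal f" using assms(5) by simp
  have ne: "topspace ?P \<noteq> {}" using assms(2) by (simp add: PiE_eq_empty_iff)
  have Msub: "M \<subseteq> mspace (C_space ?P)"
    unfolding M_def by (rule sum_functions_subset[OF assms(3)])
  have dist_le: "mdist (C_space ?P) f g \<le> a \<longleftrightarrow> (\<forall>x\<in>topspace ?P. \<bar>f x - g x\<bar> \<le> a)"
    if "g \<in> M" for g a
    using cfunspace_mdist_le[OF assms(5) _ ne, of g a] Msub that by (auto simp: dist_real_def)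
  have in_M: "restrict (\<lambda>x. \<Sum>i=1..n. g i (x i)) (topspace ?P) \<in> M"
    if g: "\<And>i. i \<in> {1..n} \<Longrightarrow> continuous_map (X i) euclideanreal (g i)" for g
  proof -
    \<comment> \<open>Elements of the function space are extensional, so \<open>g i\<close> has to be cut off outside \<open>X i\<close>.\<close>
    define h where "h i = restrict (g i) (topspace (X i))" for i
    have "h i \<in> mspace (C_space (X i))" if i: "i \<in> {1..n}" for i
    proof -
      have hc: "continuous_map (X i) euclideanreal (h i)"
        using continuous_map_eq[OF g[OF i]] by (simp add: h_def)
      then have "compactin euclideanreal (h i ` topspace (X i))"
        using image_compactin[OF _ hc] assms(3)[OF i] by (simp only: compact_space_def)
      then have "bounded (h i ` topspace (X i))" by (simp add: compact_imp_bounded)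
      then show ?thesis using hc by (auto simp: h_def)
    qed
    moreover have "restrict (\<lambda>x. \<Sum>i=1..n. g i (x i)) (topspace ?P) =
        restrict (\<lambda>x. \<Sum>i=1..n. h i (x i)) (topspace ?P)"
      by (intro restrict_ext sum.cong) (auto simp: h_def PiE_iff)
    ultimately show ?thesis unfolding M_def sum_functions_def by blast
  qed
  have M_ne: "M \<noteq> {}" using in_M[of "\<lambda>i a. 0"] by auto
  have E_le: "E \<le> mdist (C_space ?P) f g" if "g \<in> M" for g
    unfolding E_def approx_error_def using that unfolding M_def
    by (intro cINF_lower) (auto intro!: bdd_belowI2[of _ 0])
  have integral_le: "\<bar>cycle_integral n X l f\<bar> \<le> mdist (C_space ?P) f g"
    if l: "minimal_projection_cycle n X l" and g: "g \<in> M" for l g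
  proof -
    have l': "finite l" "l \<subseteq> topspace ?P" "projection_cycle n X l"
      using l by (auto simp: minimal_projection_cycle_def projection_cycle_def)
    obtain c where c: "normalized_vector n X l c"
      using normalized_vector_exists[OF l'(3)] by blast
    obtain h where h: "g = restrict (\<lambda>x. \<Sum>i=1..n. h i (x i)) (topspace ?P)"
      using g by (auto simp: M_def sum_functions_def)
    have c': "associated_vector n X l c" "annihilating n X l c" "(\<Sum>x\<in>l. \<bar>c x\<bar>) = 1"
      using c by (auto simp: normalized_vector_def associated_vector_iff)
    have "\<bar>f x - (\<Sum>i=1..n. h i (x i))\<bar> \<le> mdist (C_space ?P) f g" if "x \<in> topspace ?P" for x
      using dist_le[OF g, of "mdist (C_space ?P) f g"] that by (auto simp: h)
    from cycle_sum_le[where f = f and g = h, OF l'(1,2) c'(2) this] show ?thesis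
      using abs_cycle_integral[OF l c'(1) cont] c'(3) by simp
  qed
  have integral_le_E: "\<bar>cycle_integral n X l f\<bar> \<le> E" if "minimal_projection_cycle n X l" for l
    unfolding E_def approx_error_def using M_ne integral_le[OF that] unfolding M_def
    by (intro cINF_greatest) auto
  have "0 \<le> E"
    unfolding E_def approx_error_def using M_ne unfolding M_def by (intro cINF_greatest) auto
  then have "S \<le> E"
    unfolding S_def using integral_le_E by (auto intro: cSUP_least)
  have le_S: "\<bar>cycle_integral n X l f\<bar> \<le> S" if l: "minimal_projection_cycle n X l" for l
  proof -
    have "bdd_above ((\<lambda>l. \<bar>cycle_integral n X l f\<bar>) ` {l. minimal_projection_cycle n X l})"
      using integral_le_E by (auto intro!: bdd_aboveI2)
    then show ?thesis unfolding S_def using l by (auto intro!: cSUP_upper)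
  qed
  have S_nonneg: "0 \<le> S"
  proof (cases "\<exists>l. minimal_projection_cycle n X l")
    case True
    then show ?thesis using le_S abs_ge_zero order_trans by blast
  qed (simp add: S_def)
  have bound: "(\<Sum>x\<in>l. c x * f x) \<le> S * (\<Sum>x\<in>l. \<bar>c x\<bar>)"
    if l: "minimal_projection_cycle n X l" and c: "associated_vector n X l c" for l c
  proof -
    have "(\<Sum>x\<in>l. c x * f x) \<le> \<bar>cycle_integral n X l f\<bar> * (\<Sum>x\<in>l. \<bar>c x\<bar>)"
      using abs_cycle_integral[OF l c cont] by linarith
    also have "\<dots> \<le> S * (\<Sum>x\<in>l. \<bar>c x\<bar>)"
      using le_S[OF l] by (intro mult_right_mono sum_nonneg) auto
    finally show ?thesis .
  qed
  have "E \<le> S"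
  proof (rule field_le_epsilon)
    fix e :: real assume e: "0 < e"
    define d where "d = e / real n"
    have d: "0 < d" "real n * d = e" using e assms(1) by (auto simp: d_def)
    obtain A where A: "\<forall>i\<in>{1..n}. finite (A i) \<and> A i \<subseteq> topspace (X i)"
      and lift: "\<forall>u D. (\<forall>y\<in>PiE {1..n} A. \<bar>f y - (\<Sum>i\<in>{1..n}. u i (y i))\<bar> \<le> D) \<longrightarrow>
        (\<exists>g. (\<forall>i\<in>{1..n}. continuous_map (X i) euclideanreal (g i)) \<and>
             (\<forall>x\<in>topspace ?P. \<bar>f x - (\<Sum>i\<in>{1..n}. g i (x i))\<bar> \<le> D + real (card {1..n}) * d))"
      using approximation_from_grid[of "{1..n}" X f d] assms(2,3) cont d(1) by auto
    obtain u where "\<forall>y\<in>PiE {1..n} A. \<bar>f y - (\<Sum>i=1..n. u i (y i))\<bar> \<le> S"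
      using grid_approximation[of n A X S f] A S_nonneg bound by blast
    with lift obtain g where g: "\<forall>i\<in>{1..n}. continuous_map (X i) euclideanreal (g i)"
      "\<forall>x\<in>topspace ?P. \<bar>f x - (\<Sum>i=1..n. g i (x i))\<bar> \<le> S + e"
      using d(2) by (metis card_atLeastAtMost diff_Suc_1)
    define G where "G = restrict (\<lambda>x. \<Sum>i=1..n. g i (x i)) (topspace ?P)"
    have "G \<in> M" unfolding G_def using g(1) by (intro in_M) auto
    moreover have "mdist (C_space ?P) f G \<le> S + e"
      unfolding dist_le[OF \<open>G \<in> M\<close>] using g(2) by (simp add: G_def)
    ultimately show "E \<le> S + e" using E_le by force
  qed
  with \<open>S \<le> E\<close> show ?thesis by (simp add: E_def S_def)
qed

end
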